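(* Let $\mathbb{K}\in\{\mathbb{R},\mathbb{C}\}$, let $A,E\in\mathbb{K}^{m\times n}$, put $\widetilde{A}=A+E$, and let $k=\operatorname{rank}(A)$. Let $I\subset\{1,\dots,m\}$ and $J\subset\{1,\dots,n\}$, and put $C=A(:,J)$, $R=A(I,:)$, $U=A(I,J)$, $\widetilde{C}=\widetilde{A}(:,J)$, $\widetilde{R}=\widetilde{A}(I,:)$, $E_I=E(I,:)$, $E_J=E(:,J)$. Assume $\operatorname{rank}(C)=\operatorname{rank}(U)=\operatorname{rank}(R)=k$. Let $A=W_k\Sigma_kV_k^*$ be a compact SVD of $A$, and let $W_{k,I}=W_k(I,:)$, $V_{k,J}=V_k(J,:)$. Let $\|\cdot\|$ be a normalized, uniformly generated, unitarily invariant, submultiplicative norm. Then \[ \|A-\widetilde{C}\widetilde{C}^\dagger \widetilde{A}\widetilde{R}^\dagger \widetilde{R}\|\leq \|E_I\|\,\|AR^\dagger\|+\|E_J\|\,\|C^\dagger A\|+3\|E\|,\] and hence \[\|A-\widetilde{C}\widetilde{C}^\dagger \widetilde{A}\widetilde{R}^\dagger \widetilde{R}\|\leq \|E\|\left(\|W_{k,I}^\dagger\|+\|V_{k,J}^\dagger\|+3\right).\]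
   Context: For a matrix $B$ and index sets $I,J$, $B(I,J)$ is the submatrix with rows in $I$ and columns in $J$; $B(I,:)$ keeps all columns and $B(:,J)$ keeps all rows. $B^\dagger$ is the Moore--Penrose pseudoinverse. The compact SVD of a rank-$k$ matrix $A\in\mathbb{K}^{m\times n}$ is $A=W_k\Sigma_kV_k^*$ with $W_k\in\mathbb{K}^{m\times k}$, $V_k\in\mathbb{K}^{n\times k}$ having orthonormal columns and $\Sigma_k$ the $k\times k$ diagonal matrix of the positive singular values in descending order. A "normalized, uniformly generated, unitarily invariant, submultiplicative norm" is a family of norms $\|\cdot\|:\bigcup_{p,q\ge 1}\mathbb{K}^{p\times q}\to\mathbb{R}$ (a norm on each $\mathbb{K}^{p\times q}$) such that: $\|x\|=\|x\|_2$ (Euclidean norm) for every vector $x$ viewed as a matrix (normalized); there is a single symmetric function $\phi$ with $\|B\|=\phi(\sigma_1(B),\dots,\sigma_r(B))$, $r=\operatorname{rank}(B)$, for matrices $B$ of every size (uniformly generated); $\|\cdot\|$ is invariant under left and right multiplication by unitary matrices; and $\|BD\|\le\|B\|\|D\|$ whenever $BD$ is defined. All Schatten $p$-norms, $1\le p\le\infty$, are examples. *)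

theory Defs
  imports
    "HOL-Computational_Algebra.Computational_Algebra"
    "Jordan_Normal_Form.Schur_Decomposition"
    "Jordan_Normal_Form.Char_Poly"
    "Jordan_Normal_Form.DL_Rank"
    "Jordan_Normal_Form.DL_Submatrix"
begin

text \<open>
  The scalar field \<open>K\<close> is a subset of the complex numbers, either \<open>\<real>\<close> or \<open>UNIV\<close>, and a matrix
  over \<open>K\<close> is a complex matrix with all entries in \<open>K\<close>. Rank, adjoint, pseudoinverse and singular
  values of a real matrix do not change when it is read as a complex one; for real matrices
  \<open>mat_adjoint\<close> is the transpose and unitary means orthogonal.

  Rows and columns are numbered from 0. The submatrix \<open>B(I,J)\<close> is \<open>submatrix B I J\<close>, with the
  selected rows and columns in increasing order, and \<open>UNIV\<close> as an index set keeps everything.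
\<close>

definition mats_over :: "complex set \<Rightarrow> nat \<Rightarrow> nat \<Rightarrow> complex mat set" where
  "mats_over K p q = {B \<in> carrier_mat p q. elements_mat B \<subseteq> K}"

definition mat_rank :: "complex mat \<Rightarrow> nat" where
  "mat_rank B = vec_space.rank (dim_row B) B"

definition is_pinv :: "complex mat \<Rightarrow> complex mat \<Rightarrow> bool" where
  "is_pinv B X \<longleftrightarrow>
     X \<in> carrier_mat (dim_col B) (dim_row B) \<and>
     B * X * B = B \<and> X * B * X = X \<and>
     mat_adjoint (B * X) = B * X \<and> mat_adjoint (X * B) = X * B"

text \<open>The four Penrose equations have exactly one solution, so the description is proper.\<close>

definition pinv :: "complex mat \<Rightarrow> complex mat" where
  "pinv B = (THE X. is_pinv B X)"

text \<open>
  The positive singular values in descending order, with multiplicity: the square roots of the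
  nonzero eigenvalues of \<open>B\<^sup>* B\<close>. These eigenvalues are real and positive, so \<open>cmod\<close> only
  converts their type.
\<close>

definition singular_values :: "complex mat \<Rightarrow> real list" where
  "singular_values B =
     rev (sorted_list_of_multiset
       (image_mset (\<lambda>x. sqrt (cmod x))
         (filter_mset (\<lambda>x. x \<noteq> 0) (proots (char_poly (mat_adjoint B * B))))))"

definition compact_svd ::
  "complex set \<Rightarrow> complex mat \<Rightarrow> complex mat \<Rightarrow> complex mat \<Rightarrow> complex mat \<Rightarrow> bool" where
  "compact_svd K B W S V \<longleftrightarrow>
     (let k = mat_rank B in
       W \<in> mats_over K (dim_row B) k \<and> mat_adjoint W * W = 1\<^sub>m k \<and>
       V \<in> mats_over K (dim_col B) k \<and> mat_adjoint V * V = 1\<^sub>m k \<and>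
       S = mat_diag k (\<lambda>i. complex_of_real (singular_values B ! i)) \<and>
       B = W * S * mat_adjoint V)"

text \<open>
  A norm on each space of \<open>p \<times> q\<close> matrices over \<open>K\<close>; the values of \<open>N\<close> on other matrices are
  irrelevant. The sizes \<open>p = 0\<close> and \<open>q = 0\<close> are included because empty matrices arise when an
  index set is empty or the rank is 0. There the conditions just say that \<open>N\<close> is 0, and every
  family given for \<open>p, q \<ge> 1\<close> with the properties below keeps them when extended in this way.
\<close>

definition matrix_norm_family :: "complex set \<Rightarrow> (complex mat \<Rightarrow> real) \<Rightarrow> bool" where
  "matrix_norm_family K N \<longleftrightarrow>
     (\<forall>p q. \<forall>B \<in> mats_over K p q.
        0 \<le> N B \<and> (N B = 0 \<longleftrightarrow> B = 0\<^sub>m p q) \<and>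
        (\<forall>c \<in> K. N (c \<cdot>\<^sub>m B) = cmod c * N B) \<and>
        (\<forall>D \<in> mats_over K p q. N (B + D) \<le> N B + N D))"

text \<open>Vectors are viewed as matrices with one column.\<close>

definition normalized_norm :: "complex set \<Rightarrow> (complex mat \<Rightarrow> real) \<Rightarrow> bool" where
  "normalized_norm K N \<longleftrightarrow>
     (\<forall>p. \<forall>x \<in> mats_over K p 1. N x = sqrt (\<Sum>i<p. (cmod (x $$ (i, 0)))\<^sup>2))"

text \<open>
  The symmetric function takes any number of arguments and is therefore a function of lists that is
  invariant under permutations. It does not depend on the size of the matrix.
\<close>

definition uniformly_generated :: "complex set \<Rightarrow> (complex mat \<Rightarrow> real) \<Rightarrow> bool" where
  "uniformly_generated K N \<longleftrightarrow>
     (\<exists>\<phi> :: real list \<Rightarrow> real.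
        (\<forall>xs ys. mset xs = mset ys \<longrightarrow> \<phi> xs = \<phi> ys) \<and>
        (\<forall>p q. \<forall>B \<in> mats_over K p q. N B = \<phi> (singular_values B)))"

definition unitary_over :: "complex set \<Rightarrow> nat \<Rightarrow> complex mat set" where
  "unitary_over K p =
     {Q \<in> mats_over K p p. mat_adjoint Q * Q = 1\<^sub>m p \<and> Q * mat_adjoint Q = 1\<^sub>m p}"

definition unitarily_invariant :: "complex set \<Rightarrow> (complex mat \<Rightarrow> real) \<Rightarrow> bool" where
  "unitarily_invariant K N \<longleftrightarrow>
     (\<forall>p q. \<forall>B \<in> mats_over K p q. \<forall>P \<in> unitary_over K p. \<forall>Q \<in> unitary_over K q.
        N (P * B) = N B \<and> N (B * Q) = N B)"

definition submultiplicative :: "complex set \<Rightarrow> (complex mat \<Rightarrow> real) \<Rightarrow> bool" where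
  "submultiplicative K N \<longleftrightarrow>
     (\<forall>p q r. \<forall>B \<in> mats_over K p q. \<forall>D \<in> mats_over K q r. N (B * D) \<le> N B * N D)"

end

theory Submission
  imports Defs
begin

text \<open>
  Let \<open>P\<close> be the orthogonal projection onto the range of the perturbed columns and \<open>Q\<close> the one onto
  the range of the adjoint of the perturbed rows, so that the approximation is \<open>P (A + E) Q\<close>. The error is
  \<open>A - P (A + E) Q = (1 - P) A + P A (1 - Q) - P E Q\<close>.
  As \<open>C\<close> has the rank of \<open>A\<close>, the columns of \<open>A\<close> lie in the range of \<open>C\<close> and \<open>A = C C\<^sup>\<dagger> A\<close>
  (\<open>col_sample_recovers\<close>). The projection \<open>1 - P\<close> kills the perturbed columns, hence it sends \<open>C\<close> to \<open>- (1 - P) E\<^sub>J\<close>,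
  and \<open>(1 - P) A = - (1 - P) E\<^sub>J C\<^sup>\<dagger> A\<close>. The term with \<open>1 - Q\<close> is treated in the same way by taking adjoints.
  Multiplication by an orthogonal projection does not increase a unitarily invariant norm
  (\<open>norm_projection_le\<close>), because \<open>P X\<close> is the mean of \<open>X\<close> and its image under the reflection \<open>2 P - 1\<close>. So the
  three terms are bounded by \<open>\<parallel>E\<^sub>J\<parallel> \<parallel>C\<^sup>\<dagger> A\<parallel>\<close>, \<open>\<parallel>E\<^sub>I\<parallel> \<parallel>A R\<^sup>\<dagger>\<parallel>\<close> and \<open>\<parallel>E\<parallel>\<close>. This is
  \<open>cur_projection_perturbation\<close>, a bound with \<open>\<parallel>E\<parallel>\<close> in place of \<open>3 \<parallel>E\<parallel>\<close>.

  For the second inequality, cancelling the invertible factors of the singular value decomposition gives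
  \<open>A R\<^sup>\<dagger> = W W\<^sub>I\<^sup>\<dagger>\<close> and \<open>C\<^sup>\<dagger> A = (V V\<^sub>J\<^sup>\<dagger>)\<^sup>*\<close> (\<open>mult_pinv_row_sample\<close>, \<open>pinv_col_sample_mult\<close>). The isometries \<open>W\<close> and
  \<open>V\<close> do not change singular values, hence not the norm. Nor does the adjoint, because \<open>B\<^sup>* B\<close> and
  \<open>B B\<^sup>*\<close> have the same nonzero eigenvalues (\<open>char_poly_commute\<close>). Finally a submatrix of \<open>E\<close> has at most the
  norm of \<open>E\<close>, since a selection of rows is a projection up to an isometry (\<open>norm_coisometry_le\<close>).
\<close>

section \<open>Matrix algebra and adjoints\<close>

text \<open>
  Stated with dimensions instead of carriers, so that the side conditions are solved by rewriting
  and the equation can serve as a rewrite rule.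
\<close>

lemma mat_assoc:
  fixes A B C :: "'a :: semiring_0 mat"
  assumes "dim_col A = dim_row B" "dim_col B = dim_row C"
  shows "A * B * C = A * (B * C)"
  by (rule assoc_mult_mat[of A "dim_row A" "dim_row B" B "dim_row C" C "dim_col C"])
    (use assms in auto)

lemma mat_adjoint_dim [simp]:
  "dim_row (mat_adjoint A) = dim_col A" "dim_col (mat_adjoint A) = dim_row A"
  by (auto simp: mat_adjoint_def)

lemma mat_adjoint_carrier: "A \<in> carrier_mat m n \<Longrightarrow> mat_adjoint A \<in> carrier_mat n m"
  by (auto intro!: carrier_matI)

lemma mat_adjoint_index [simp]:
  fixes A :: "complex mat"
  assumes "i < dim_col A" "j < dim_row A"
  shows "mat_adjoint A $$ (i, j) = cnj (A $$ (j, i))"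
  using assms by (auto simp: mat_adjoint_def mat_of_rows_def)

lemma mat_adjoint_adjoint [simp]: "mat_adjoint (mat_adjoint A) = (A :: complex mat)"
  by (intro eq_matI) auto

lemma mat_adjoint_one [simp]: "mat_adjoint (1\<^sub>m n) = (1\<^sub>m n :: complex mat)"
  by (intro eq_matI) auto

lemma mat_adjoint_mult:
  fixes A B :: "complex mat"
  assumes "dim_col A = dim_row B"
  shows "mat_adjoint (A * B) = mat_adjoint B * mat_adjoint A"
  using assms by (intro eq_matI) (auto simp: scalar_prod_def mult.commute)

lemma adjoint_mult_eq_0:
  fixes B :: "complex mat"
  assumes B: "B \<in> carrier_mat m n" and z: "mat_adjoint B * B = 0\<^sub>m n n"
  shows "B = 0\<^sub>m m n"
proof (rule eq_matI)
  fix i j assume "i < dim_row (0\<^sub>m m n :: complex mat)" "j < dim_col (0\<^sub>m m n :: complex mat)"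
  then have ij: "i < m" "j < n" by auto
  have "(mat_adjoint B * B) $$ (j, j) = (\<Sum>l<m. cnj (B $$ (l, j)) * B $$ (l, j))"
    using B ij by (auto simp: scalar_prod_def atLeast0LessThan)
  also have "\<dots> = complex_of_real (\<Sum>l<m. (cmod (B $$ (l, j)))\<^sup>2)"
    by (simp add: complex_norm_square mult.commute flip: of_real_power)
  finally have "(\<Sum>l<m. (cmod (B $$ (l, j)))\<^sup>2) = 0"
    using z ij by (metis index_zero_mat(1) of_real_eq_0_iff)
  then have "\<forall>l\<in>{..<m}. (cmod (B $$ (l, j)))\<^sup>2 = 0"
    by (subst (asm) sum_nonneg_eq_0_iff) auto
  with ij show "B $$ (i, j) = 0\<^sub>m m n $$ (i, j)" by auto
qed (use B in auto)

section \<open>Rank\<close>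

text \<open>
  The set \<open>U\<close> ranges over the column space and not only over the columns, because it is applied to
  columns of a product \<open>A * T\<close>, which need not be columns of \<open>A\<close>.
\<close>

lemma (in vec_space) card_indpt_in_col_space_le_rank:
  assumes A: "A \<in> carrier_mat n nc" and U: "U \<subseteq> span (set (cols A))" "lin_indpt U"
  shows "finite U" "card U \<le> rank A"
proof -
  let ?W = "span (set (cols A))"
  have c: "set (cols A) \<subseteq> carrier_vec n" using cols_dim[of A] A by auto
  have sub: "submodule class_ring ?W V" using c by (rule span_is_submodule)
  have vs: "vectorspace class_ring (vs ?W)" using span_is_subspace[OF c] subspace_is_vs by auto
  have fd: "vectorspace.fin_dim class_ring (vs ?W)" using fin_dim_span_cols[OF A] .
  have li: "LinearCombinations.module.lin_indpt class_ring (vs ?W) U"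
    using span_li_not_depend(2)[OF U(1) sub] U(2) by simp
  have "U \<subseteq> carrier (vs ?W)" using U by simp
  from vectorspace.li_le_dim[OF vs fd this li]
  show "finite U" "card U \<le> rank A" unfolding rank_def by auto
qed

lemma (in vec_space) col_basis:
  assumes A: "A \<in> carrier_mat n nc"
  obtains S where "finite S" "S \<subseteq> set (cols A)" "lin_indpt S" "card S = rank A"
    "span S = span (set (cols A))"
proof -
  have c: "set (cols A) \<subseteq> carrier_vec n" using cols_dim[of A] A by auto
  obtain S where S: "finite S" "maximal S (\<lambda>T. T \<subseteq> set (cols A) \<and> lin_indpt T)"
    using maximal_exists_superset[of "set (cols A)" "\<lambda>T. T \<subseteq> set (cols A) \<and> lin_indpt T" "{}"]
    by (auto simp: lin_dep_def)
  then have Ssub: "S \<subseteq> set (cols A)" and li: "lin_indpt S" by (auto simp: maximal_def)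
  have Sc: "S \<subseteq> carrier_vec n" using Ssub c by auto
  have "s \<in> span S" if s: "s \<in> set (cols A)" for s
  proof (rule ccontr)
    assume n: "s \<notin> span S"
    then have "s \<notin> S" using span_mem[OF Sc] by auto
    moreover have "lin_indpt (S \<union> {s})"
      using lin_dep_iff_in_span[OF Sc li] n s c calculation by blast
    ultimately show False using S(2) Ssub s unfolding maximal_def
      by (metis (no_types, lifting) Un_insert_right Un_subset_iff insert_iff insert_subset subset_insertI sup_bot_right)
  qed
  then have "span (set (cols A)) \<subseteq> span S"
    using span_is_subset[OF _ span_is_submodule[OF Sc]] Sc by (meson span_subsetI subsetI c)
  with span_is_monotone[OF Ssub] have "span S = span (set (cols A))" by auto
  with S Ssub li rank_card_indpt[OF A S(2)] show ?thesis using that by auto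
qed

lemma (in vec_space) span_cols_mult:
  assumes A: "A \<in> carrier_mat n p" and B: "B \<in> carrier_mat p q"
  shows "set (cols (A * B)) \<subseteq> span (set (cols A))"
proof
  fix v assume "v \<in> set (cols (A * B))"
  then obtain j where j: "j < q" "v = col (A * B) j"
    using A B by (auto simp: cols_def)
  then have "v = A *\<^sub>v col B j" using A B by auto
  then show "v \<in> span (set (cols A))"
    using col_space_eq[OF A] A B j unfolding col_space_def by auto
qed

lemma (in vec_space) factor_through_col_space:
  assumes A: "A \<in> carrier_mat n p" and B: "B \<in> carrier_mat n q"
    and sub: "set (cols B) \<subseteq> span (set (cols A))"
  obtains Z where "Z \<in> carrier_mat p q" "B = A * Z"
proof -
  have "\<exists>x. x \<in> carrier_vec p \<and> A *\<^sub>v x = col B j" if "j < q" for j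
  proof -
    have "col B j \<in> set (cols B)" using that B by (auto simp: cols_def)
    then show ?thesis using sub col_space_eq[OF A] A unfolding col_space_def by auto
  qed
  then obtain x where x: "\<And>j. j < q \<Longrightarrow> x j \<in> carrier_vec p \<and> A *\<^sub>v x j = col B j" by metis
  let ?Z = "mat_of_cols p (map x [0..<q])"
  have "B = A * ?Z"
  proof (rule mat_col_eqI)
    fix j assume "j < dim_col (A * ?Z)"
    then have j: "j < q" by simp
    have "col (A * ?Z) j = A *\<^sub>v col ?Z j" using j A by (subst col_mult2[of A n p ?Z q]) auto
    also have "col ?Z j = x j" using j x by simp
    finally show "col B j = col (A * ?Z) j" using x j by simp
  qed (use A B in auto)
  then show ?thesis by (rule that[rotated]) (simp add: mat_of_cols_def)
qed

lemma mat_rank_mult_le: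
  assumes "dim_col A = dim_row B"
  shows "mat_rank (A * B) \<le> mat_rank A"
proof -
  interpret vec_space "TYPE(complex)" "dim_row A" .
  have A: "A \<in> carrier_mat (dim_row A) (dim_col A)"
    and B: "B \<in> carrier_mat (dim_col A) (dim_col B)"
    and AB: "A * B \<in> carrier_mat (dim_row A) (dim_col B)" using assms by auto
  from AB obtain S where S: "S \<subseteq> set (cols (A * B))" "lin_indpt S" "card S = rank (A * B)"
    using col_basis by metis
  then have "S \<subseteq> span (set (cols A))" using span_cols_mult[OF A B] by blast
  with card_indpt_in_col_space_le_rank(2)[OF A this S(2)] S(3)
  show ?thesis unfolding mat_rank_def by simp
qed

lemma mat_rank_le_dim_col: "mat_rank A \<le> dim_col A"
  unfolding mat_rank_def by (rule vec_space.rank_le_nc[of _ "dim_row A"]) auto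

text \<open>
  The columns of \<open>F\<close> are a basis of the column space chosen among the columns of \<open>A\<close>, and \<open>G\<close> holds
  the coordinates of the columns of \<open>A\<close> in this basis.
\<close>

lemma rank_factorization:
  assumes A: "A \<in> carrier_mat m n"
  obtains F G where "F \<in> carrier_mat m (mat_rank A)" "G \<in> carrier_mat (mat_rank A) n" "A = F * G"
proof -
  interpret vec_space "TYPE(complex)" m .
  from A obtain S where S: "finite S" "S \<subseteq> set (cols A)" "card S = rank A"
    "span S = span (set (cols A))"
    using col_basis by metis
  have c: "set (cols A) \<subseteq> carrier_vec m" using cols_dim[of A] A by auto
  obtain xs where xs: "set xs = S" "distinct xs" using S(1) finite_distinct_list by auto
  let ?F = "mat_of_cols m xs"
  have len: "length xs = mat_rank A" using distinct_card[OF xs(2)] xs(1) S(3) A by (auto simp: mat_rank_def)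
  have F: "?F \<in> carrier_mat m (mat_rank A)" using len by auto
  have "cols ?F = xs" using cols_mat_of_cols[of xs m] xs(1) S(2) c by auto
  then have "set (cols A) \<subseteq> span (set (cols ?F))"
    using S(4) xs(1) span_mem[OF c] by auto
  from factor_through_col_space[OF F A this] show ?thesis using that[OF F] by blast
qed

text \<open>
  Taking adjoints in a rank factorization bounds the rank of the adjoint by the inner dimension;
  equality follows by symmetry.
\<close>

lemma mat_rank_adjoint [simp]: "mat_rank (mat_adjoint A) = mat_rank A"
proof -
  have le: "mat_rank (mat_adjoint B) \<le> mat_rank B" for B
  proof -
    obtain F G where FG: "F \<in> carrier_mat (dim_row B) (mat_rank B)"
      "G \<in> carrier_mat (mat_rank B) (dim_col B)" "B = F * G"
      by (rule rank_factorization[OF carrier_matI[OF refl refl, of B]])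
    have d: "dim_col F = mat_rank B" "dim_row G = mat_rank B" using FG(1,2) by auto
    have "mat_adjoint B = mat_adjoint G * mat_adjoint F"
      using mat_adjoint_mult[of F G] d FG(3) by metis
    then have "mat_rank (mat_adjoint B) \<le> mat_rank (mat_adjoint G)"
      using d mat_rank_mult_le[of "mat_adjoint G" "mat_adjoint F"] by (metis mat_adjoint_dim)
    also have "\<dots> \<le> mat_rank B" using mat_rank_le_dim_col[of "mat_adjoint G"] d by simp
    finally show ?thesis .
  qed
  show ?thesis using le[of A] le[of "mat_adjoint A"] by simp
qed

lemma mat_rank_one [simp]: "mat_rank (1\<^sub>m k) = k"
  using vec_space.det_rank_iff[of "1\<^sub>m k :: complex mat" k] by (auto simp: mat_rank_def)

text \<open>
  The column space of \<open>A * T\<close> lies in that of \<open>A\<close>. If the dimensions agree the two spaces are equal,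
  so every column of \<open>A\<close> is a combination of columns of \<open>A * T\<close>. The ranks of \<open>C\<close> and \<open>R\<close> enter the
  estimates through this factorization.
\<close>

lemma factor_through_equal_rank:
  assumes A: "A \<in> carrier_mat m n" and T: "T \<in> carrier_mat n q"
    and rank: "mat_rank (A * T) = mat_rank A"
  obtains Z where "Z \<in> carrier_mat q n" "A = A * T * Z"
proof -
  interpret vec_space "TYPE(complex)" m .
  have AT: "A * T \<in> carrier_mat m q" using A T by auto
  then obtain S where S: "finite S" "S \<subseteq> set (cols (A * T))" "lin_indpt S"
    "card S = rank (A * T)" "span S = span (set (cols (A * T)))"
    using col_basis by metis
  have c: "set (cols A) \<subseteq> carrier_vec m" using cols_dim[of A] A by auto
  have c': "set (cols (A * T)) \<subseteq> carrier_vec m" using cols_dim[of "A * T"] AT by (metis carrier_matD(1))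
  have "s \<in> span S" if s: "s \<in> set (cols A)" for s
  proof (rule ccontr)
    assume n: "s \<notin> span S"
    have Sc: "S \<subseteq> carrier_vec m" using S(2) c' by auto
    then have sS: "s \<notin> S" using n span_mem by auto
    have "lin_indpt (S \<union> {s})"
      using lin_dep_iff_in_span[OF Sc S(3)] n s c sS by blast
    moreover have "S \<union> {s} \<subseteq> span (set (cols A))"
      using S(2) span_cols_mult[OF A T] s span_mem[OF c] by auto
    ultimately have "card (S \<union> {s}) \<le> rank A"
      using card_indpt_in_col_space_le_rank(2)[OF A] by blast
    then show False using sS S(1,4) rank A AT by (simp add: mat_rank_def)
  qed
  then have "set (cols A) \<subseteq> span (set (cols (A * T)))" using S(5) by auto
  from factor_through_col_space[OF AT A this] show ?thesis using that by blast
qed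

section \<open>The Moore--Penrose inverse\<close>

text \<open>
  For the adjoint of \<open>F\<close>, full rank means that the identity matrix factors through it.
\<close>

lemma full_col_rank_left_inverse:
  assumes F: "F \<in> carrier_mat m r" and rank: "mat_rank F = r"
  obtains L where "L \<in> carrier_mat r m" "L * F = 1\<^sub>m r"
proof -
  have F': "mat_adjoint F \<in> carrier_mat r m" using F by (rule mat_adjoint_carrier)
  then have "mat_rank (1\<^sub>m r * mat_adjoint F) = mat_rank (1\<^sub>m r)" using rank left_mult_one_mat[OF F'] by simp
  from factor_through_equal_rank[OF one_carrier_mat F' this]
  obtain Z where Z: "Z \<in> carrier_mat m r" "1\<^sub>m r = 1\<^sub>m r * mat_adjoint F * Z" by blast
  have "mat_adjoint Z * F = mat_adjoint (mat_adjoint F * Z)"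
    using F Z by (subst mat_adjoint_mult) auto
  also have "mat_adjoint F * Z = 1\<^sub>m r" using Z(2) by (simp only: left_mult_one_mat[OF F'])
  finally show ?thesis using that[of "mat_adjoint Z"] mat_adjoint_carrier[OF Z(1)] by simp
qed

text \<open>
  If \<open>F\<^sup>* F v = 0\<close> then \<open>(F v)\<^sup>* (F v) = 0\<close>, hence \<open>F v = 0\<close>, and \<open>v = 0\<close> because \<open>F\<close> has a left inverse.
\<close>

lemma gram_matrix_inverse:
  assumes F: "F \<in> carrier_mat m r" and rank: "mat_rank F = r"
  obtains P where "P \<in> carrier_mat r r" "P * (mat_adjoint F * F) = 1\<^sub>m r"
    "mat_adjoint F * F * P = 1\<^sub>m r" "mat_adjoint P = P"
proof -
  let ?H = "mat_adjoint F * F"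
  have H: "?H \<in> carrier_mat r r" using F by (auto intro!: carrier_matI)
  note [simp] = carrier_matD[OF F]
  obtain L where L: "L \<in> carrier_mat r m" "L * F = 1\<^sub>m r"
    using full_col_rank_left_inverse[OF assms] by blast
  have "det ?H \<noteq> 0"
  proof
    assume "det ?H = 0"
    then obtain v where v: "v \<in> carrier_vec r" "v \<noteq> 0\<^sub>v r" "?H *\<^sub>v v = 0\<^sub>v r"
      using det_0_iff_vec_prod_zero_field[OF H] by blast
    \<comment> \<open>The vector is turned into a matrix with one column, so that adjoints apply to it.\<close>
    define X where "X = mat_of_cols r [v]"
    have X: "X \<in> carrier_mat r 1" by (simp add: X_def mat_of_cols_def)
    note [simp] = carrier_matD[OF X]
    have HX: "?H * X = 0\<^sub>m r 1"
    proof (rule mat_col_eqI)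
      fix j assume "j < dim_col (0\<^sub>m r 1 :: complex mat)"
      then have j: "j = 0" by simp
      have "col (?H * X) 0 = ?H *\<^sub>v col X 0" using col_mult2[OF H X] by simp
      also have "col X 0 = v" using v(1) by (simp add: X_def)
      finally show "col (?H * X) j = col (0\<^sub>m r 1) j" using v(3) j by simp
    qed (use H X in auto)
    have "mat_adjoint (F * X) * (F * X) = mat_adjoint X * (?H * X)"
      by (simp add: mat_adjoint_mult mat_assoc)
    also have "\<dots> = 0\<^sub>m 1 1"
      using right_mult_zero_mat[OF mat_adjoint_carrier[OF X]] by (simp add: HX)
    finally have "F * X = 0\<^sub>m m 1" by (rule adjoint_mult_eq_0[rotated]) (use F X in auto)
    then have "L * F * X = 0\<^sub>m r 1" using L(1) by (simp add: mat_assoc)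
    then have "X = 0\<^sub>m r 1" using L(2) X by simp
    moreover have "col X 0 = v" using v(1) by (simp add: X_def)
    ultimately show False using v(2) by simp
  qed
  then have "?H \<in> Units (ring_mat TYPE(complex) r ())"
    by (rule det_non_zero_imp_unit[OF H])
  then obtain P where P: "P \<in> carrier_mat r r" "P * ?H = 1\<^sub>m r" "?H * P = 1\<^sub>m r"
    by (auto simp: Units_def ring_mat_def)
  have "mat_adjoint P * ?H = mat_adjoint (?H * P)"
    using carrier_matD[OF P(1)] mat_adjoint_mult[of ?H P] mat_adjoint_mult[of "mat_adjoint F" F]
    by simp
  then have PH: "mat_adjoint P * ?H = 1\<^sub>m r" by (simp only: P(3) mat_adjoint_one)
  have "mat_adjoint P = mat_adjoint P * (?H * P)" using P mat_adjoint_carrier[OF P(1)] by simp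
  also have "\<dots> = mat_adjoint P * ?H * P" using P by (simp add: mat_assoc)
  also have "\<dots> = P" using PH P by simp
  finally show ?thesis using that P by blast
qed

text \<open>
  A rank factorization \<open>B = F G\<close> gives the pseudoinverse explicitly as
  \<open>G\<^sup>* (G G\<^sup>*)\<^sup>-\<^sup>1 (F\<^sup>* F)\<^sup>-\<^sup>1 F\<^sup>*\<close>: both products with \<open>B\<close> collapse to the Hermitian matrices
  \<open>F (F\<^sup>* F)\<^sup>-\<^sup>1 F\<^sup>*\<close> and \<open>G\<^sup>* (G G\<^sup>*)\<^sup>-\<^sup>1 G\<close>.
\<close>

lemma is_pinv_exists: "\<exists>X. is_pinv B X"
proof -
  define m n r where "m = dim_row B" and "n = dim_col B" and "r = mat_rank B"
  have Bc: "B \<in> carrier_mat m n" unfolding m_def n_def by (rule carrier_matI[OF refl refl])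
  obtain F G where F: "F \<in> carrier_mat m r" and G: "G \<in> carrier_mat r n" and B: "B = F * G"
    using rank_factorization[OF Bc] unfolding r_def by metis
  note [simp] = carrier_matD[OF F] carrier_matD[OF G]
  have "r \<le> mat_rank F" using mat_rank_mult_le[of F G] B by (simp add: r_def)
  then have rF: "mat_rank F = r" using mat_rank_le_dim_col[of F] by simp
  have "r = mat_rank (mat_adjoint G * mat_adjoint F)"
    using B mat_adjoint_mult[of F G] by (metis carrier_matD F G r_def mat_rank_adjoint)
  then have "r \<le> mat_rank (mat_adjoint G)"
    using mat_rank_mult_le[of "mat_adjoint G" "mat_adjoint F"] by simp
  then have rG: "mat_rank (mat_adjoint G) = r"
    using mat_rank_le_dim_col[of "mat_adjoint G"] by simp
  obtain P where P: "P \<in> carrier_mat r r" "P * (mat_adjoint F * F) = 1\<^sub>m r"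
    "mat_adjoint F * F * P = 1\<^sub>m r" "mat_adjoint P = P"
    using gram_matrix_inverse[OF F rF] by blast
  obtain Q where Q: "Q \<in> carrier_mat r r" "Q * (G * mat_adjoint G) = 1\<^sub>m r"
    "G * mat_adjoint G * Q = 1\<^sub>m r" "mat_adjoint Q = Q"
    using gram_matrix_inverse[OF mat_adjoint_carrier[OF G] rG] by auto
  note [simp] = carrier_matD[OF P(1)] carrier_matD[OF Q(1)]
  have p: "P * (mat_adjoint F * (F * Y)) = Y" if "dim_row Y = r" for Y
  proof -
    have "P * (mat_adjoint F * (F * Y)) = P * (mat_adjoint F * F) * Y"
      using that by (simp add: mat_assoc)
    also have "\<dots> = Y" unfolding P(2) by (rule left_mult_one_mat[OF carrier_matI[OF that refl]])
    finally show ?thesis .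
  qed
  have q: "G * (mat_adjoint G * (Q * Y)) = Y" if "dim_row Y = r" for Y
  proof -
    have "G * (mat_adjoint G * (Q * Y)) = G * mat_adjoint G * Q * Y"
      using that by (simp add: mat_assoc)
    also have "\<dots> = Y" unfolding Q(3) by (rule left_mult_one_mat[OF carrier_matI[OF that refl]])
    finally show ?thesis .
  qed
  let ?X = "mat_adjoint G * (Q * (P * mat_adjoint F))"
  have BX: "F * G * ?X = F * (P * mat_adjoint F)" by (simp add: mat_assoc q)
  have XB: "?X * (F * G) = mat_adjoint G * (Q * G)" by (simp add: mat_assoc p)
  have "is_pinv (F * G) ?X"
    unfolding is_pinv_def BX XB
    by (auto simp: mat_assoc p q mat_adjoint_mult P(4) Q(4) intro!: carrier_matI)
  then show ?thesis using B by blast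
qed

text \<open>
  The classical argument: for two solutions \<open>X\<close> and \<open>Y\<close>, the Hermitian conditions give
  \<open>B X = B Y\<close> and \<open>X B = Y B\<close>, whence \<open>X = X B X = X B Y = Y B Y = Y\<close>.
\<close>

lemma is_pinv_unique:
  assumes X: "is_pinv B X" and Y: "is_pinv B Y"
  shows "X = Y"
proof -
  have [simp]: "dim_row X = dim_col B" "dim_col X = dim_row B"
    "dim_row Y = dim_col B" "dim_col Y = dim_row B"
    using X Y by (auto simp: is_pinv_def)
  have X': "B * X * B = B" "X * B * X = X" "mat_adjoint (B * X) = B * X" "mat_adjoint (X * B) = X * B"
    and Y': "B * Y * B = B" "Y * B * Y = Y" "mat_adjoint (B * Y) = B * Y" "mat_adjoint (Y * B) = Y * B"
    using X Y by (auto simp: is_pinv_def)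
  have "B * X = mat_adjoint (B * Y * B * X)" using X'(3) Y'(1) by simp
  also have "\<dots> = mat_adjoint ((B * Y) * (B * X))" by (simp add: mat_assoc)
  also have "\<dots> = (B * X) * (B * Y)" using X'(3) Y'(3) by (simp add: mat_adjoint_mult[of "B * Y" "B * X"])
  also have "\<dots> = B * X * B * Y" by (simp add: mat_assoc)
  also have "\<dots> = B * Y" using X'(1) by simp
  finally have 1: "B * X = B * Y" .
  have "X * B = mat_adjoint (X * (B * Y * B))" using X'(4) Y'(1) by simp
  also have "\<dots> = mat_adjoint ((X * B) * (Y * B))" by (simp add: mat_assoc)
  also have "\<dots> = (Y * B) * (X * B)" using X'(4) Y'(4) by (simp add: mat_adjoint_mult[of "X * B" "Y * B"])
  also have "\<dots> = Y * (B * X * B)" by (simp add: mat_assoc)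
  also have "\<dots> = Y * B" using X'(1) by simp
  finally have 2: "X * B = Y * B" .
  have "X = X * (B * X)" using X'(2) by (simp add: mat_assoc)
  also have "\<dots> = X * B * Y" using 1 by (simp add: mat_assoc)
  also have "\<dots> = Y" using 2 Y'(2) by simp
  finally show ?thesis .
qed

lemma pinv_eqI: "is_pinv B X \<Longrightarrow> pinv B = X"
  unfolding pinv_def using is_pinv_unique by blast

lemma is_pinv_pinv: "is_pinv B (pinv B)"
  using is_pinv_exists pinv_eqI by metis

lemma pinv_dim [simp]: "dim_row (pinv B) = dim_col B" "dim_col (pinv B) = dim_row B"
  using is_pinv_pinv[of B] by (auto simp: is_pinv_def)

lemma pinv_carrier: "B \<in> carrier_mat m n \<Longrightarrow> pinv B \<in> carrier_mat n m"
  by (auto intro!: carrier_matI)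

lemma penrose:
  "B * pinv B * B = B" "pinv B * B * pinv B = pinv B"
  "mat_adjoint (B * pinv B) = B * pinv B" "mat_adjoint (pinv B * B) = pinv B * B"
  using is_pinv_pinv[of B] by (auto simp: is_pinv_def)

lemma pinv_adjoint: "pinv (mat_adjoint B) = mat_adjoint (pinv B)"
proof (rule pinv_eqI)
  let ?X = "pinv B"
  have a: "mat_adjoint B * mat_adjoint ?X = ?X * B" "mat_adjoint ?X * mat_adjoint B = B * ?X"
    using penrose(3,4)[of B] by (simp_all add: mat_adjoint_mult)
  have "mat_adjoint B * mat_adjoint ?X * mat_adjoint B = mat_adjoint (B * ?X * B)"
    "mat_adjoint ?X * mat_adjoint B * mat_adjoint ?X = mat_adjoint (?X * B * ?X)"
    by (simp_all add: mat_adjoint_mult mat_assoc)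
  then show "is_pinv (mat_adjoint B) (mat_adjoint ?X)"
    unfolding is_pinv_def using penrose[of B] a by (auto intro!: carrier_matI)
qed

section \<open>Matrices over the scalar field\<close>

lemma mats_over_iff:
  "B \<in> mats_over K p q \<longleftrightarrow> B \<in> carrier_mat p q \<and> (\<forall>i<p. \<forall>j<q. B $$ (i, j) \<in> K)"
  by (auto simp: mats_over_def dest!: elements_matD)

lemma mats_over_carrier: "B \<in> mats_over K p q \<Longrightarrow> B \<in> carrier_mat p q"
  by (simp add: mats_over_def)

text \<open>
  The Penrose equations are preserved by entrywise conjugation. By uniqueness the pseudoinverse of a
  real matrix is therefore fixed by conjugation, that is, real.
\<close>

lemma is_pinv_map_cnj:
  assumes "is_pinv B X"
  shows "is_pinv (map_mat cnj B) (map_mat cnj X)"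
proof -
  have mult: "map_mat cnj (A * C) = map_mat cnj A * map_mat cnj C" if "dim_col A = dim_row C" for A C
    using that by (intro eq_matI) (auto simp: scalar_prod_def)
  have adj: "mat_adjoint (map_mat cnj A) = map_mat cnj (mat_adjoint A)" for A
    by (intro eq_matI) auto
  have dims: "dim_row X = dim_col B" "dim_col X = dim_row B"
    using assms by (auto simp: is_pinv_def)
  show ?thesis
    using assms dims unfolding is_pinv_def
    by (simp add: adj flip: mult)
qed

locale scalar_field =
  fixes K :: "complex set"
  assumes real_or_complex: "K = \<real> \<or> K = UNIV"
begin

lemma Reals_subset: "\<real> \<subseteq> K"
  using real_or_complex by auto

lemma add_closed: "B \<in> mats_over K p q \<Longrightarrow> D \<in> mats_over K p q \<Longrightarrow> B + D \<in> mats_over K p q"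
  using real_or_complex by (auto simp: mats_over_iff)

lemma minus_closed: "B \<in> mats_over K p q \<Longrightarrow> D \<in> mats_over K p q \<Longrightarrow> B - D \<in> mats_over K p q"
  using real_or_complex by (auto simp: mats_over_iff)

lemma smult_closed: "c \<in> \<real> \<Longrightarrow> B \<in> mats_over K p q \<Longrightarrow> c \<cdot>\<^sub>m B \<in> mats_over K p q"
  using real_or_complex by (auto simp: mats_over_iff)

lemma mult_closed: "B \<in> mats_over K p q \<Longrightarrow> D \<in> mats_over K q r \<Longrightarrow> B * D \<in> mats_over K p r"
  using real_or_complex
  by (auto simp: mats_over_iff scalar_prod_def intro!: sum_in_Reals Reals_mult)

lemma adjoint_closed: "B \<in> mats_over K p q \<Longrightarrow> mat_adjoint B \<in> mats_over K q p"
  using real_or_complex by (auto simp: mats_over_iff mat_adjoint_carrier)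

lemma one_closed: "1\<^sub>m p \<in> mats_over K p p"
  using real_or_complex by (auto simp: mats_over_iff)

lemma pinv_closed:
  assumes B: "B \<in> mats_over K p q"
  shows "pinv B \<in> mats_over K q p"
proof -
  have c: "pinv B \<in> carrier_mat q p" using mats_over_carrier[OF B] by (rule pinv_carrier)
  show ?thesis
  proof (cases "K = \<real>")
    case True
    have "map_mat cnj B = B"
      using B True by (intro eq_matI) (auto simp: mats_over_iff Reals_cnj_iff)
    then have "pinv B = map_mat cnj (pinv B)"
      using is_pinv_map_cnj[OF is_pinv_pinv[of B]] by (intro pinv_eqI) simp
    then have "cnj (pinv B $$ (i, j)) = pinv B $$ (i, j)" if "i < q" "j < p" for i j
      using that c by (metis carrier_matD index_map_mat(1))
    then show ?thesis using c True by (auto simp: mats_over_iff Reals_cnj_iff)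
  qed (use real_or_complex c in \<open>auto simp: mats_over_iff\<close>)
qed

lemma submatrix_closed:
  assumes B: "B \<in> mats_over K p q"
  shows "submatrix B I J \<in> mats_over K (card {i. i < p \<and> i \<in> I}) (card {j. j < q \<and> j \<in> J})"
  using B by (auto simp: mats_over_iff dim_submatrix submatrix_index pick_le intro!: carrier_matI)

end

section \<open>Submatrices as products\<close>

text \<open>
  Multiplication by this matrix from the left selects the rows in \<open>I\<close>, and multiplication by an
  adjoint of such a matrix from the right selects columns. It turns statements on submatrices into
  matrix algebra.
\<close>

definition sel_rows :: "nat \<Rightarrow> nat set \<Rightarrow> complex mat" where
  "sel_rows m I = submatrix (1\<^sub>m m) I UNIV"

lemma sel_rows_dim [simp]:
  "dim_row (sel_rows m I) = card {i. i < m \<and> i \<in> I}" "dim_col (sel_rows m I) = m"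
  by (auto simp: sel_rows_def dim_submatrix)

lemma sel_rows_index:
  assumes "i < card {i. i < m \<and> i \<in> I}" "j < m"
  shows "sel_rows m I $$ (i, j) = (if pick I i = j then 1 else 0)"
  using assms pick_le[OF assms(1)] by (simp add: sel_rows_def submatrix_index pick_UNIV)

text \<open>
  The rows are distinct unit vectors, because \<^term>\<open>pick I\<close> is injective below the number of selected
  indices.
\<close>

lemma sel_rows_coisometry: "sel_rows m I * mat_adjoint (sel_rows m I) = 1\<^sub>m (card {i. i < m \<and> i \<in> I})"
proof (rule eq_matI)
  let ?c = "card {i. i < m \<and> i \<in> I}"
  fix i j assume "i < dim_row (1\<^sub>m ?c :: complex mat)" "j < dim_col (1\<^sub>m ?c :: complex mat)"
  then have ij: "i < ?c" "j < ?c" by auto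
  have c: "?c \<le> card I" if "finite I" using that by (intro card_mono) auto
  have ci: "x < card I \<or> infinite I" if "x < ?c" for x using that c by fastforce
  have inj: "pick I i = pick I j \<longleftrightarrow> i = j"
    using pick_mono[OF ci[OF ij(1)], of j] pick_mono[OF ci[OF ij(2)], of i]
    by (metis less_irrefl nat_neq_iff)
  have "(sel_rows m I * mat_adjoint (sel_rows m I)) $$ (i, j)
      = (\<Sum>l = 0..<m. (if pick I i = l then 1 else 0) * (if pick I j = l then 1 else 0))"
    using ij by (auto simp: scalar_prod_def sel_rows_index intro!: sum.cong)
  also have "\<dots> = (if i = j then 1 else 0)"
    using pick_le[OF ij(1)] inj by (auto simp: if_distrib[where f = "\<lambda>x. x * _"] cong: if_cong)
  finally show "(sel_rows m I * mat_adjoint (sel_rows m I)) $$ (i, j) = 1\<^sub>m ?c $$ (i, j)"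
    using ij by simp
qed auto

lemma submatrix_rows:
  assumes A: "A \<in> carrier_mat m n"
  shows "submatrix A I UNIV = sel_rows m I * A"
proof (rule eq_matI)
  fix i j assume "i < dim_row (sel_rows m I * A)" "j < dim_col (sel_rows m I * A)"
  then have ij: "i < card {i. i < m \<and> i \<in> I}" "j < n" using A by auto
  have "(sel_rows m I * A) $$ (i, j) = (\<Sum>l = 0..<m. (if pick I i = l then 1 else 0) * A $$ (l, j))"
    using ij A by (auto simp: scalar_prod_def sel_rows_index intro!: sum.cong)
  also have "\<dots> = A $$ (pick I i, j)"
    using pick_le[OF ij(1)] by (simp add: if_distrib[where f = "\<lambda>x. x * _"] cong: if_cong)
  finally show "submatrix A I UNIV $$ (i, j) = (sel_rows m I * A) $$ (i, j)"
    using ij A by (simp add: submatrix_index pick_UNIV)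
qed (use A in \<open>auto simp: dim_submatrix\<close>)

lemma submatrix_cols:
  assumes A: "A \<in> carrier_mat m n"
  shows "submatrix A UNIV J = A * mat_adjoint (sel_rows n J)"
proof (rule eq_matI)
  fix i j assume "i < dim_row (A * mat_adjoint (sel_rows n J))" "j < dim_col (A * mat_adjoint (sel_rows n J))"
  then have ij: "i < m" "j < card {j. j < n \<and> j \<in> J}" using A by auto
  have "(A * mat_adjoint (sel_rows n J)) $$ (i, j)
      = (\<Sum>l = 0..<n. (if pick J j = l then 1 else 0) * A $$ (i, l))"
    using ij A by (auto simp: scalar_prod_def sel_rows_index intro!: sum.cong)
  also have "\<dots> = A $$ (i, pick J j)"
    using pick_le[OF ij(2)] by (simp add: if_distrib[where f = "\<lambda>x. x * _"] cong: if_cong)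
  finally show "submatrix A UNIV J $$ (i, j) = (A * mat_adjoint (sel_rows n J)) $$ (i, j)"
    using ij A by (simp add: submatrix_index pick_UNIV)
qed (use A in \<open>auto simp: dim_submatrix\<close>)

lemma (in scalar_field) sel_rows_closed: "sel_rows m I \<in> mats_over K (card {i. i < m \<and> i \<in> I}) m"
  using submatrix_closed[OF one_closed, of m I UNIV] by (simp add: sel_rows_def)

section \<open>Singular values\<close>

text \<open>
  With \<open>M\<close> the block matrix of \<open>x \<cdot> 1\<close>, \<open>A\<close>, \<open>B\<close> and \<open>1\<close>, the determinant of \<open>M\<close> is computed twice.
  Multiplication by a block matrix of determinant 1 clears the lower left block and leaves
  \<open>x \<cdot> 1 - A B\<close> and \<open>1\<close> on the diagonal; multiplication by one of determinant \<open>x\<^sup>n\<close> clears the upper right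
  block and leaves \<open>x \<cdot> 1\<close> and \<open>x \<cdot> 1 - B A\<close>.
\<close>

lemma char_poly_commute:
  fixes A B :: "complex mat"
  assumes A: "A \<in> carrier_mat m n" and B: "B \<in> carrier_mat n m"
  shows "char_poly (A * B) * [:0, 1:] ^ n = [:0, 1:] ^ m * char_poly (B * A)"
proof -
  let ?c = "\<lambda>A. map_mat (\<lambda>a. [:a:]) (A :: complex mat)"
  let ?x = "\<lambda>k. [:0, 1:] \<cdot>\<^sub>m (1\<^sub>m k :: complex poly mat)"
  have cA: "?c A \<in> carrier_mat m n" and cB: "?c B \<in> carrier_mat n m" using A B by auto
  have one: "1\<^sub>m k \<in> carrier_mat k k" "?x k \<in> carrier_mat k k" for k by auto
  have csum: "[:sum f S:] = (\<Sum>x\<in>S. [:f x:])" for f :: "nat \<Rightarrow> complex" and S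
    by (rule poly_eqI) (simp add: coeff_sum coeff_pCons split: nat.split)
  have cmult: "?c (C * D) = ?c C * ?c D" if "dim_col C = dim_row D" for C D
    using that by (intro eq_matI) (auto simp: scalar_prod_def csum mult.commute)
  have cAB: "?c (A * B) = ?c A * ?c B" "?c (B * A) = ?c B * ?c A"
    using A B by (auto intro!: cmult)
  have cp: "det (?x k - ?c M) = char_poly M" if "M \<in> carrier_mat k k" for k M
    unfolding char_poly_defs using that by (intro arg_cong[of _ _ det] eq_matI) auto
  let ?M = "four_block_mat (?x m) (?c A) (?c B) (1\<^sub>m n)"
  let ?N1 = "four_block_mat (1\<^sub>m m) (0\<^sub>m m n) (- ?c B) (1\<^sub>m n)"
  let ?N2 = "four_block_mat (1\<^sub>m m) (- ?c A) (0\<^sub>m n m) (?x n)"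
  have M: "?M \<in> carrier_mat (m + n) (m + n)" using cA cB by auto
  have xI: "?x k * 1\<^sub>m k = ?x k" "1\<^sub>m k * ?x k = ?x k" for k
    by (rule right_mult_one_mat[OF one(2)], rule left_mult_one_mat[OF one(2)])
  have xm: "?x m * (- ?c A) = - ([:0, 1:] \<cdot>\<^sub>m ?c A)" and xn: "?c A * ?x n = [:0, 1:] \<cdot>\<^sub>m ?c A"
    using cA by (simp_all add: mult_smult_assoc_mat[of _ m m _ n] mult_smult_distrib[of _ m n _ n])
  have b1: "?x m * 1\<^sub>m m + ?c A * (- ?c B) = ?x m - ?c (A * B)"
    "?x m * 0\<^sub>m m n + ?c A * 1\<^sub>m n = ?c A"
    "?c B * 1\<^sub>m m + 1\<^sub>m n * (- ?c B) = 0\<^sub>m n m"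
    "?c B * 0\<^sub>m m n + 1\<^sub>m n * 1\<^sub>m n = 1\<^sub>m n"
    unfolding xI cAB
    using cA cB by (auto simp: right_mult_zero_mat[OF one(2)] intro!: eq_matI)
  have b2: "?x m * 1\<^sub>m m + ?c A * 0\<^sub>m n m = ?x m"
    "?x m * (- ?c A) + ?c A * ?x n = 0\<^sub>m m n"
    "?c B * 1\<^sub>m m + 1\<^sub>m n * 0\<^sub>m n m = ?c B"
    "?c B * (- ?c A) + 1\<^sub>m n * ?x n = ?x n - ?c (B * A)"
    unfolding xI xm xn cAB
    using cA cB by (auto simp: right_mult_zero_mat[OF cA] intro!: eq_matI)
  have 1: "?M * ?N1 = four_block_mat (?x m - ?c (A * B)) (?c A) (0\<^sub>m n m) (1\<^sub>m n)"
    by (subst mult_four_block_mat[OF one(2) cA cB one(1) one(1) zero_carrier_mat _ one(1)])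
      (use cB in \<open>simp_all only: b1 uminus_carrier_iff_mat\<close>)
  have 2: "?M * ?N2 = four_block_mat (?x m) (0\<^sub>m m n) (?c B) (?x n - ?c (B * A))"
    by (subst mult_four_block_mat[OF one(2) cA cB one(1) one(1) _ zero_carrier_mat one(2)])
      (use cA in \<open>simp_all only: b2 uminus_carrier_iff_mat\<close>)
  have dx: "det (?x k) = [:0, 1:] ^ k" for k by simp
  have N1: "?N1 \<in> carrier_mat (m + n) (m + n)" and N2: "?N2 \<in> carrier_mat (m + n) (m + n)"
    using cA cB by auto
  have "det ?N1 = 1"
    by (subst det_four_block_mat_upper_right_zero[of _ m _ n]) (use cB in auto)
  moreover have "det ?N2 = [:0, 1:] ^ n"
    by (subst det_four_block_mat_lower_left_zero[of _ m _ n]) (use cA in auto)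
  moreover have "det (?M * ?N1) = char_poly (A * B)"
    unfolding 1 by (subst det_four_block_mat_lower_left_zero[of _ m _ n]) (use cA A B cp[of "A * B" m] in auto)
  moreover have "det (?M * ?N2) = [:0, 1:] ^ m * char_poly (B * A)"
    unfolding 2 by (subst det_four_block_mat_upper_right_zero[of _ m _ n]) (use cB A B cp[of "B * A" n] in auto)
  ultimately show ?thesis
    unfolding det_mult[OF M N1] det_mult[OF M N2] by simp
qed

text \<open>
  The powers of \<open>x\<close> by which the two characteristic polynomials differ contribute only roots 0.
\<close>

lemma nonzero_eigenvalues_commute:
  fixes A B :: "complex mat"
  assumes A: "A \<in> carrier_mat m n" and B: "B \<in> carrier_mat n m"
  shows "filter_mset (\<lambda>x. x \<noteq> 0) (proots (char_poly (A * B)))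
    = filter_mset (\<lambda>x. x \<noteq> 0) (proots (char_poly (B * A)))"
proof -
  have nz: "char_poly M \<noteq> 0" if "M \<in> carrier_mat k k" for M :: "complex mat" and k
    using degree_monic_char_poly[OF that] by auto
  have x: "filter_mset (\<lambda>x. x \<noteq> 0) (proots ([:0, 1:] ^ k)) = {#}" for k
    by (rule multiset_eqI) (simp add: proots_power)
  have xnz: "[:0, 1 :: complex:] ^ k \<noteq> 0" for k by simp
  have "proots (char_poly (A * B)) + proots ([:0, 1:] ^ n)
      = proots ([:0, 1:] ^ m) + proots (char_poly (B * A))"
    using char_poly_commute[OF A B] xnz[of n] xnz[of m] nz[of "A * B" m] nz[of "B * A" n] A B
    by (simp add: proots_mult [symmetric])
  from arg_cong[OF this, of "filter_mset (\<lambda>x. x \<noteq> 0)"] show ?thesis by (simp add: x)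
qed

lemma singular_values_adjoint: "singular_values (mat_adjoint B) = singular_values B"
  using nonzero_eigenvalues_commute[OF carrier_matI[OF refl refl] carrier_matI, of B "mat_adjoint B"]
  by (simp add: singular_values_def)

text \<open>
  The factor \<open>W\<close> disappears from the Gram matrix: \<open>(W X)\<^sup>* (W X) = X\<^sup>* X\<close>.
\<close>

lemma singular_values_isometry:
  assumes X: "dim_row X = dim_col W" and W: "mat_adjoint W * W = 1\<^sub>m (dim_col W)"
  shows "singular_values (W * X) = singular_values X"
proof -
  have "mat_adjoint (W * X) * (W * X) = mat_adjoint X * ((mat_adjoint W * W) * X)"
    using X by (simp add: mat_adjoint_mult mat_assoc)
  also have "(mat_adjoint W * W) * X = X"
    unfolding W by (rule left_mult_one_mat[OF carrier_matI[OF X refl]])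
  finally show ?thesis by (simp add: singular_values_def)
qed

section \<open>Orthogonal projections\<close>

text \<open>
  The first equation forces \<open>P\<close> to be square.
\<close>

definition orth_projection :: "complex mat \<Rightarrow> bool" where
  "orth_projection P \<longleftrightarrow> mat_adjoint P = P \<and> P * P = P"

lemma orth_projection_pinv:
  "orth_projection (B * pinv B)" "orth_projection (pinv B * B)"
proof -
  have "B * pinv B * (B * pinv B) = B * pinv B * B * pinv B"
    "pinv B * B * (pinv B * B) = pinv B * B * pinv B * B"
    by (simp_all add: mat_assoc)
  then show "orth_projection (B * pinv B)" "orth_projection (pinv B * B)"
    using penrose[of B] by (simp_all add: orth_projection_def)
qed

lemma mat_adjoint_minus:
  fixes A B :: "complex mat"
  assumes "A \<in> carrier_mat m n" "B \<in> carrier_mat m n"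
  shows "mat_adjoint (A - B) = mat_adjoint A - mat_adjoint B"
  using assms by (intro eq_matI) auto

lemma mat_adjoint_add:
  fixes A B :: "complex mat"
  assumes "A \<in> carrier_mat m n" "B \<in> carrier_mat m n"
  shows "mat_adjoint (A + B) = mat_adjoint A + mat_adjoint B"
  using assms by (intro eq_matI) auto

lemma one_minus_mult:
  fixes P Y :: "complex mat"
  assumes "P \<in> carrier_mat p p" "Y \<in> carrier_mat p q"
  shows "(1\<^sub>m p - P) * Y = Y - P * Y"
  using assms by (simp add: minus_mult_distrib_mat[of _ p p])

lemma mult_one_minus:
  fixes P Y :: "complex mat"
  assumes "P \<in> carrier_mat p p" "Y \<in> carrier_mat q p"
  shows "Y * (1\<^sub>m p - P) = Y - Y * P"
  using mult_minus_distrib_mat[OF assms(2) one_carrier_mat assms(1)] assms by simp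

lemma orth_projection_complement:
  assumes P: "P \<in> carrier_mat p p" and proj: "orth_projection P"
  shows "orth_projection (1\<^sub>m p - P)"
proof -
  have c: "1\<^sub>m p - P \<in> carrier_mat p p" using P by (rule minus_carrier_mat)
  have "P * (1\<^sub>m p - P) = P - P" using mult_one_minus[OF P P] proj by (simp add: orth_projection_def)
  then have "(1\<^sub>m p - P) * (1\<^sub>m p - P) = 1\<^sub>m p - P - (P - P)"
    using one_minus_mult[OF P c] by simp
  also have "\<dots> = 1\<^sub>m p - P" using P by (intro eq_matI) auto
  finally show ?thesis
    using proj mat_adjoint_minus[OF one_carrier_mat P] by (simp add: orth_projection_def)
qed

text \<open>
  The matrix \<open>2 P - 1\<close> is the reflection in the range of \<open>P\<close>.
\<close>

lemma reflection_unitary: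
  assumes P: "P \<in> carrier_mat p p" and proj: "orth_projection P"
  shows "mat_adjoint (P + P - 1\<^sub>m p) = P + P - 1\<^sub>m p"
    "(P + P - 1\<^sub>m p) * (P + P - 1\<^sub>m p) = 1\<^sub>m p"
proof -
  let ?H = "P + P - 1\<^sub>m p"
  have PP: "P + P \<in> carrier_mat p p" and H: "?H \<in> carrier_mat p p" using P by auto
  show "mat_adjoint ?H = ?H"
    using proj mat_adjoint_minus[OF PP one_carrier_mat] mat_adjoint_add[OF P P]
    by (simp add: orth_projection_def)
  have "P * ?H = P * P + P * P - P"
    using mult_minus_distrib_mat[OF P PP one_carrier_mat] mult_add_distrib_mat[OF P P P] P by simp
  also have "\<dots> = P" using P proj by (intro eq_matI) (auto simp: orth_projection_def)
  finally have PH: "P * ?H = P" .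
  have "?H * ?H = P * ?H + P * ?H - ?H"
    using P PP H by (simp add: minus_mult_distrib_mat[of _ p p] add_mult_distrib_mat[of _ p p])
  also have "\<dots> = 1\<^sub>m p" unfolding PH using P by (intro eq_matI) auto
  finally show "?H * ?H = 1\<^sub>m p" .
qed

section \<open>Unitarily invariant norms\<close>

locale ui_norm = scalar_field +
  fixes N :: "complex mat \<Rightarrow> real"
  assumes norm_family: "matrix_norm_family K N"
    and generated: "uniformly_generated K N"
    and invariant: "unitarily_invariant K N"
    and submult: "submultiplicative K N"
begin

lemma norm_nonneg: "B \<in> mats_over K p q \<Longrightarrow> 0 \<le> N B"
  using norm_family by (auto simp: matrix_norm_family_def)

lemma norm_triangle: "B \<in> mats_over K p q \<Longrightarrow> D \<in> mats_over K p q \<Longrightarrow> N (B + D) \<le> N B + N D"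
  using norm_family unfolding matrix_norm_family_def by blast

lemma norm_smult: "c \<in> \<real> \<Longrightarrow> B \<in> mats_over K p q \<Longrightarrow> N (c \<cdot>\<^sub>m B) = cmod c * N B"
  using norm_family Reals_subset unfolding matrix_norm_family_def by blast

lemma norm_uminus:
  assumes B: "B \<in> mats_over K p q"
  shows "N (- B) = N B"
proof -
  have "- B = (-1) \<cdot>\<^sub>m B" by (intro eq_matI) auto
  then show ?thesis using norm_smult[of "-1", OF _ B] by simp
qed

lemma norm_triangle_minus:
  assumes B: "B \<in> mats_over K p q" and D: "D \<in> mats_over K p q"
  shows "N (B - D) \<le> N B + N D"
proof -
  have "- D = (-1) \<cdot>\<^sub>m D" by (intro eq_matI) auto
  then have D': "- D \<in> mats_over K p q" using smult_closed[of "-1", OF _ D] by simp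
  have "B - D = B + - D" using mats_over_carrier[OF B] mats_over_carrier[OF D]
    by (simp add: minus_add_uminus_mat)
  then show ?thesis using norm_triangle[OF B D'] norm_uminus[OF D] by simp
qed

lemma norm_mult: "B \<in> mats_over K p q \<Longrightarrow> D \<in> mats_over K q r \<Longrightarrow> N (B * D) \<le> N B * N D"
  using submult unfolding submultiplicative_def by blast

lemma norm_eqI_singular_values:
  assumes "B \<in> mats_over K p q" "D \<in> mats_over K r s" "singular_values B = singular_values D"
  shows "N B = N D"
  using generated assms unfolding uniformly_generated_def by metis

lemma norm_adjoint: "B \<in> mats_over K p q \<Longrightarrow> N (mat_adjoint B) = N B"
  by (rule norm_eqI_singular_values[OF adjoint_closed _ singular_values_adjoint])

text \<open>
  For a rectangular \<open>W\<close> unitary invariance does not apply, as the two sides have different sizes. This is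
  where the norms of all sizes must come from one function of the singular values.
\<close>

lemma norm_isometry:
  assumes W: "W \<in> mats_over K p r" and iso: "mat_adjoint W * W = 1\<^sub>m r" and X: "X \<in> mats_over K r q"
  shows "N (W * X) = N X"
proof (rule norm_eqI_singular_values[OF mult_closed[OF W X] X singular_values_isometry])
  show "dim_row X = dim_col W" "mat_adjoint W * W = 1\<^sub>m (dim_col W)"
    using iso mats_over_carrier[OF W] mats_over_carrier[OF X] by auto
qed

lemma norm_unitary:
  assumes H: "H \<in> unitary_over K p" and X: "X \<in> mats_over K p q"
  shows "N (H * X) = N X"
proof -
  have "1\<^sub>m q \<in> unitary_over K q" using one_closed by (simp add: unitary_over_def)
  with H X invariant show ?thesis unfolding unitarily_invariant_def by blast
qed

text \<open>
  The norm of a projection may exceed 1 (the Frobenius norm does), so submultiplicativity is too weak.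
  Instead, \<open>P X\<close> is the mean of \<open>X\<close> and its reflection \<open>(2 P - 1) X\<close>, which has the same norm as \<open>X\<close>.
\<close>

lemma norm_projection_le:
  assumes P: "P \<in> mats_over K p p" and proj: "orth_projection P" and X: "X \<in> mats_over K p q"
  shows "N (P * X) \<le> N X"
proof -
  let ?H = "P + P - 1\<^sub>m p"
  note Pc = mats_over_carrier[OF P] and Xc = mats_over_carrier[OF X]
  have H: "?H \<in> mats_over K p p" by (intro minus_closed add_closed one_closed P)
  then have "?H \<in> unitary_over K p"
    using reflection_unitary[OF Pc proj] by (simp add: unitary_over_def)
  then have HX: "N (?H * X) = N X" using X by (rule norm_unitary)
  have "?H * X = P * X + P * X - X"
    using Pc Xc by (simp add: minus_mult_distrib_mat[of _ p p] add_mult_distrib_mat[of _ p p])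
  then have "P * X = (1 / 2) \<cdot>\<^sub>m (X + ?H * X)"
    using Pc Xc by (intro eq_matI) auto
  then have "N (P * X) = 1 / 2 * N (X + ?H * X)"
    using norm_smult[of "1 / 2", OF _ add_closed[OF X mult_closed[OF H X]]] by simp
  also have "\<dots> \<le> 1 / 2 * (N X + N (?H * X))"
    using norm_triangle[OF X mult_closed[OF H X]] by simp
  finally show ?thesis using HX by simp
qed

lemma norm_projection_right_le:
  assumes P: "P \<in> mats_over K p p" and proj: "orth_projection P" and X: "X \<in> mats_over K q p"
  shows "N (X * P) \<le> N X"
proof -
  have "mat_adjoint (X * P) = P * mat_adjoint X"
    using proj mats_over_carrier[OF P] mats_over_carrier[OF X]
    by (simp add: mat_adjoint_mult orth_projection_def)
  then show ?thesis
    using norm_projection_le[OF P proj adjoint_closed[OF X]]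
      norm_adjoint[OF mult_closed[OF X P]] norm_adjoint[OF X] by simp
qed

text \<open>
  By invariance under the isometry \<open>L\<^sup>*\<close>, the norm of \<open>L X\<close> is that of \<open>L\<^sup>* L X\<close>, and \<open>L\<^sup>* L\<close> is an orthogonal
  projection. Applied to selection matrices, this bounds a submatrix by the whole matrix.
\<close>

lemma norm_coisometry_le:
  assumes L: "L \<in> mats_over K r p" and co: "L * mat_adjoint L = 1\<^sub>m r" and X: "X \<in> mats_over K p q"
  shows "N (L * X) \<le> N X"
proof -
  let ?P = "mat_adjoint L * L"
  note [simp] = carrier_matD[OF mats_over_carrier[OF L]] carrier_matD[OF mats_over_carrier[OF X]]
  have P: "?P \<in> mats_over K p p" by (rule mult_closed[OF adjoint_closed[OF L] L])
  have "?P * ?P = mat_adjoint L * (L * mat_adjoint L * L)" by (simp add: mat_assoc)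
  also have "\<dots> = ?P" unfolding co using left_mult_one_mat[OF mats_over_carrier[OF L]] by simp
  finally have proj: "orth_projection ?P" by (simp add: orth_projection_def mat_adjoint_mult)
  have "N (L * X) = N (mat_adjoint L * (L * X))"
    using norm_isometry[OF adjoint_closed[OF L] _ mult_closed[OF L X]] co by simp
  also have "mat_adjoint L * (L * X) = ?P * X" by (simp add: mat_assoc)
  also have "N \<dots> \<le> N X" by (rule norm_projection_le[OF P proj X])
  finally show ?thesis .
qed

end

section \<open>Recovering a matrix from a sample of full rank\<close>

text \<open>
  The columns of \<open>A\<close> lie in the range of \<open>A T\<close>, on which the projection \<open>A T (A T)\<^sup>\<dagger>\<close> is the identity.
\<close>

lemma col_sample_recovers:
  assumes A: "A \<in> carrier_mat m n" and T: "T \<in> carrier_mat n q"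
    and rank: "mat_rank (A * T) = mat_rank A"
  shows "A * T * pinv (A * T) * A = A"
proof -
  note [simp] = carrier_matD[OF A] carrier_matD[OF T]
  obtain Z where Z: "Z \<in> carrier_mat q n" "A = A * T * Z"
    using factor_through_equal_rank[OF assms] .
  note [simp] = carrier_matD[OF Z(1)]
  have "A * T * pinv (A * T) * (A * T * Z) = A * T * pinv (A * T) * (A * T) * Z"
    by (simp add: mat_assoc)
  also have "\<dots> = A * T * Z" by (simp only: penrose(1))
  finally show ?thesis by (simp only: Z(2)[symmetric])
qed

lemma row_sample_recovers:
  assumes A: "A \<in> carrier_mat m n" and L: "L \<in> carrier_mat p m"
    and rank: "mat_rank (L * A) = mat_rank A"
  shows "A * pinv (L * A) * (L * A) = A"
proof -
  note [simp] = carrier_matD[OF A] carrier_matD[OF L]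
  have adj: "mat_adjoint A * mat_adjoint L = mat_adjoint (L * A)" by (simp add: mat_adjoint_mult)
  have "mat_rank (mat_adjoint A * mat_adjoint L) = mat_rank (mat_adjoint A)"
    unfolding adj using rank by simp
  from col_sample_recovers[OF mat_adjoint_carrier[OF A] mat_adjoint_carrier[OF L] this]
  have "mat_adjoint (mat_adjoint (L * A) * mat_adjoint (pinv (L * A)) * mat_adjoint A) = A"
    unfolding adj pinv_adjoint by simp
  then show ?thesis by (simp add: mat_adjoint_mult mat_assoc)
qed

section \<open>The pseudoinverses in terms of the singular vectors\<close>

text \<open>
  The rank of a product is at most the rank of each factor, so the \<open>k \<times> k\<close> matrix \<open>S\<close> has rank \<open>k\<close>.
\<close>

lemma svd_core_invertible:
  assumes A: "A \<in> carrier_mat m n" and W: "W \<in> carrier_mat m k" and S: "S \<in> carrier_mat k k"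
    and V: "V \<in> carrier_mat n k" and svd: "A = W * S * mat_adjoint V" and k: "mat_rank A = k"
  obtains Z where "Z \<in> carrier_mat k k" "S * Z = 1\<^sub>m k" "Z * S = 1\<^sub>m k"
proof -
  note [simp] = carrier_matD[OF W] carrier_matD[OF S] carrier_matD[OF V]
  have "k = mat_rank (W * S * mat_adjoint V)" using k svd by simp
  also have "\<dots> \<le> mat_rank (W * S)" by (rule mat_rank_mult_le) simp
  also have "\<dots> = mat_rank (mat_adjoint S * mat_adjoint W)"
    using mat_rank_adjoint[of "W * S"] by (simp add: mat_adjoint_mult)
  also have "\<dots> \<le> mat_rank (mat_adjoint S)" by (rule mat_rank_mult_le) simp
  finally have "mat_rank S = k" using mat_rank_le_dim_col[of S] by simp
  then have "mat_rank (1\<^sub>m k * S) = mat_rank (1\<^sub>m k)" using left_mult_one_mat[OF S] by simp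
  then obtain Z where Z: "Z \<in> carrier_mat k k" "1\<^sub>m k = 1\<^sub>m k * S * Z"
    using factor_through_equal_rank[OF one_carrier_mat S] by metis
  then have "S * Z = 1\<^sub>m k" by (simp only: left_mult_one_mat[OF S])
  with mat_mult_left_right_inverse[OF S Z(1)] Z(1) show ?thesis using that by blast
qed

text \<open>
  Put \<open>Y = S V\<^sup>* (L A)\<^sup>\<dagger>\<close>, so that \<open>A (L A)\<^sup>\<dagger> = W Y\<close>. Since \<open>A (L A)\<^sup>\<dagger> L A = A\<close>, cancelling \<open>W\<close> on the left and
  \<open>S V\<^sup>*\<close> on the right gives \<open>Y (L W) = 1\<close>. The other product \<open>L W Y = L A (L A)\<^sup>\<dagger>\<close> is Hermitian, so \<open>Y\<close>
  satisfies the Penrose equations for \<open>L W\<close>.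
\<close>

lemma mult_pinv_row_sample:
  assumes W: "W \<in> carrier_mat m k" and S: "S \<in> carrier_mat k k" and V: "V \<in> carrier_mat n k"
    and WW: "mat_adjoint W * W = 1\<^sub>m k" and VV: "mat_adjoint V * V = 1\<^sub>m k"
    and A: "A = W * S * mat_adjoint V" and k: "mat_rank A = k"
    and L: "L \<in> carrier_mat p m" and rank: "mat_rank (L * A) = mat_rank A"
  shows "A * pinv (L * A) = W * pinv (L * W)"
proof -
  have Ac: "A \<in> carrier_mat m n" unfolding A using W S V by (auto intro!: carrier_matI)
  note [simp] = carrier_matD[OF W] carrier_matD[OF S] carrier_matD[OF V] carrier_matD[OF L]
    carrier_matD[OF Ac]
  obtain Si where Si: "Si \<in> carrier_mat k k" "S * Si = 1\<^sub>m k"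
    using svd_core_invertible[OF Ac W S V A k] by metis
  note [simp] = carrier_matD[OF Si(1)]
  define X where "X = pinv (L * A)"
  have [simp]: "dim_row X = n" "dim_col X = p" by (simp_all add: X_def)
  define Y where "Y = S * (mat_adjoint V * X)"
  have [simp]: "dim_row Y = k" "dim_col Y = p" by (simp_all add: Y_def)
  have one: "1\<^sub>m k * B = B" if "dim_row B = k" for B :: "complex mat"
    by (rule left_mult_one_mat[OF carrier_matI[OF that refl]])
  have AX: "A * X = W * Y" by (simp add: A Y_def mat_assoc)
  have "A * X * (L * A) = A" unfolding X_def by (rule row_sample_recovers[OF Ac L rank])
  then have "mat_adjoint W * (W * Y * (L * A)) * V = mat_adjoint W * A * V"
    unfolding AX by simp
  then have "mat_adjoint W * W * (Y * (L * W)) * S * (mat_adjoint V * V)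
      = mat_adjoint W * W * S * (mat_adjoint V * V)"
    by (simp add: A mat_assoc)
  then have "Y * (L * W) * S = S"
    unfolding WW VV by (simp add: one right_mult_one_mat[of _ k k] carrier_matI)
  then have "Y * (L * W) * S * Si = S * Si" by simp
  then have "Y * (L * W) * (S * Si) = S * Si" by (simp add: mat_assoc)
  then have inv: "Y * (L * W) = 1\<^sub>m k"
    unfolding Si(2) by (simp add: right_mult_one_mat[of _ k k] carrier_matI)
  have herm: "mat_adjoint (L * W * Y) = L * W * Y"
  proof -
    have "L * W * Y = L * A * X" by (simp add: mat_assoc AX)
    then show ?thesis using penrose(3)[of "L * A"] unfolding X_def by simp
  qed
  have "is_pinv (L * W) Y"
    unfolding is_pinv_def inv
  proof (intro conjI)
    have "L * W * Y * (L * W) = L * W * (Y * (L * W))" by (simp add: mat_assoc)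
    also have "\<dots> = L * W" unfolding inv by (rule right_mult_one_mat[of _ p k]) (simp add: carrier_matI)
    finally show "L * W * Y * (L * W) = L * W" .
    show "1\<^sub>m k * Y = Y" by (rule one) simp
  qed (simp_all add: herm carrier_matI)
  then show ?thesis using AX pinv_eqI unfolding X_def by simp
qed

text \<open>
  This is the row version for the adjoint \<open>A\<^sup>* = V S\<^sup>* W\<^sup>*\<close>.
\<close>

lemma pinv_col_sample_mult:
  assumes W: "W \<in> carrier_mat m k" and S: "S \<in> carrier_mat k k" and V: "V \<in> carrier_mat n k"
    and WW: "mat_adjoint W * W = 1\<^sub>m k" and VV: "mat_adjoint V * V = 1\<^sub>m k"
    and A: "A = W * S * mat_adjoint V" and k: "mat_rank A = k"
    and L: "L \<in> carrier_mat q n" and rank: "mat_rank (A * mat_adjoint L) = mat_rank A"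
  shows "pinv (A * mat_adjoint L) * A = mat_adjoint (V * pinv (L * V))"
proof -
  have Ac: "A \<in> carrier_mat m n" unfolding A using W S V by (auto intro!: carrier_matI)
  note [simp] = carrier_matD[OF W] carrier_matD[OF S] carrier_matD[OF V] carrier_matD[OF L]
    carrier_matD[OF Ac]
  have A': "mat_adjoint A = V * mat_adjoint S * mat_adjoint W"
    unfolding A by (simp add: mat_adjoint_mult mat_assoc)
  have adj: "L * mat_adjoint A = mat_adjoint (A * mat_adjoint L)" by (simp add: mat_adjoint_mult)
  have "mat_adjoint A * pinv (L * mat_adjoint A) = V * pinv (L * V)"
    by (rule mult_pinv_row_sample[OF V mat_adjoint_carrier[OF S] W VV WW A' _ L])
      (use k rank in \<open>simp_all add: adj\<close>)
  then have "mat_adjoint (V * pinv (L * V))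
      = mat_adjoint (mat_adjoint A * mat_adjoint (pinv (A * mat_adjoint L)))"
    unfolding adj pinv_adjoint by simp
  then show ?thesis by (simp add: mat_adjoint_mult)
qed

section \<open>The perturbation estimate\<close>

context ui_norm
begin

text \<open>
  The complementary projection \<open>1 - P\<close> annihilates \<open>(A + E) T\<close>, so it maps \<open>A T\<close> to the negative of its value
  at \<open>E T\<close>. Writing \<open>A = A T (A T)\<^sup>\<dagger> A\<close> therefore gives
  \<open>(1 - P) A = - (1 - P) E T (A T)\<^sup>\<dagger> A\<close>.
\<close>

lemma perturbed_projection_error:
  assumes A: "A \<in> mats_over K m n" and E: "E \<in> mats_over K m n"
    and T: "T \<in> mats_over K n q" and rank: "mat_rank (A * T) = mat_rank A"
    and P: "P = (A + E) * T * pinv ((A + E) * T)"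
  shows "N ((1\<^sub>m m - P) * A) \<le> N (E * T) * N (pinv (A * T) * A)"
proof -
  note Ac = mats_over_carrier[OF A] and Ec = mats_over_carrier[OF E] and Tc = mats_over_carrier[OF T]
  note [simp] = carrier_matD[OF Ac] carrier_matD[OF Ec] carrier_matD[OF Tc]
  have ETK: "E * T \<in> mats_over K m q" by (rule mult_closed[OF E T])
  have ATK: "A * T \<in> mats_over K m q" by (rule mult_closed[OF A T])
  have CtK: "(A + E) * T \<in> mats_over K m q" by (rule mult_closed[OF add_closed[OF A E] T])
  have PK: "P \<in> mats_over K m m" unfolding P by (rule mult_closed[OF CtK pinv_closed[OF CtK]])
  have P'K: "1\<^sub>m m - P \<in> mats_over K m m" by (rule minus_closed[OF one_closed PK])
  note Pc = mats_over_carrier[OF PK] and P'c = mats_over_carrier[OF P'K]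
  note [simp] = carrier_matD[OF Pc]
  have P'proj: "orth_projection (1\<^sub>m m - P)"
    by (rule orth_projection_complement[OF Pc]) (simp add: P orth_projection_pinv)
  have "(1\<^sub>m m - P) * ((A + E) * T) = (A + E) * T - P * ((A + E) * T)"
    by (rule one_minus_mult[OF Pc mats_over_carrier[OF CtK]])
  also have "P * ((A + E) * T) = (A + E) * T" unfolding P by (rule penrose(1))
  also have "(A + E) * T - (A + E) * T = 0\<^sub>m m q" by (intro eq_matI) auto
  also have "(A + E) * T = A * T + E * T" by (rule add_mult_distrib_mat[OF Ac Ec Tc])
  also have "(1\<^sub>m m - P) * (A * T + E * T) = (1\<^sub>m m - P) * (A * T) + (1\<^sub>m m - P) * (E * T)"
    by (rule mult_add_distrib_mat[OF P'c mats_over_carrier[OF ATK] mats_over_carrier[OF ETK]])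
  finally have sum0: "(1\<^sub>m m - P) * (A * T) + (1\<^sub>m m - P) * (E * T) = 0\<^sub>m m q" .
  have neg: "(1\<^sub>m m - P) * (A * T) = - ((1\<^sub>m m - P) * (E * T))"
  proof (rule eq_matI)
    fix i j assume "i < dim_row (- ((1\<^sub>m m - P) * (E * T)))" "j < dim_col (- ((1\<^sub>m m - P) * (E * T)))"
    then have ij: "i < m" "j < q" by auto
    have "((1\<^sub>m m - P) * (A * T) + (1\<^sub>m m - P) * (E * T)) $$ (i, j) = 0" using sum0 ij by simp
    then have "((1\<^sub>m m - P) * (A * T)) $$ (i, j) + ((1\<^sub>m m - P) * (E * T)) $$ (i, j) = 0"
      using ij by (subst (asm) index_add_mat) (auto simp del: index_mult_mat(1))
    then show "((1\<^sub>m m - P) * (A * T)) $$ (i, j) = (- ((1\<^sub>m m - P) * (E * T))) $$ (i, j)"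
      using ij by (subst index_uminus_mat) (auto simp: add_eq_0_iff2 simp del: index_mult_mat(1))
  qed auto
  have CA: "pinv (A * T) * A \<in> mats_over K q n" by (rule mult_closed[OF pinv_closed[OF ATK] A])
  have P'E: "(1\<^sub>m m - P) * (E * T) \<in> mats_over K m q" by (rule mult_closed[OF P'K ETK])
  have "(1\<^sub>m m - P) * A = (1\<^sub>m m - P) * (A * T * pinv (A * T) * A)"
    by (simp only: col_sample_recovers[OF Ac Tc rank])
  also have "\<dots> = (1\<^sub>m m - P) * (A * T) * (pinv (A * T) * A)" by (simp add: mat_assoc)
  finally have "N ((1\<^sub>m m - P) * A) = N ((1\<^sub>m m - P) * (A * T) * (pinv (A * T) * A))" by simp
  also have "\<dots> \<le> N ((1\<^sub>m m - P) * (A * T)) * N (pinv (A * T) * A)"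
    by (rule norm_mult[OF mult_closed[OF P'K ATK] CA])
  also have "N ((1\<^sub>m m - P) * (A * T)) = N ((1\<^sub>m m - P) * (E * T))"
    unfolding neg by (rule norm_uminus[OF P'E])
  also have "\<dots> * N (pinv (A * T) * A) \<le> N (E * T) * N (pinv (A * T) * A)"
    by (rule mult_right_mono[OF norm_projection_le[OF P'K P'proj ETK] norm_nonneg[OF CA]])
  finally show ?thesis .
qed

text \<open>
  The row version is the column version for \<open>A\<^sup>*\<close> and \<open>E\<^sup>*\<close>, since \<open>Q\<close> is Hermitian and the norm is
  invariant under adjoints.
\<close>

lemma perturbed_row_projection_error:
  assumes A: "A \<in> mats_over K m n" and E: "E \<in> mats_over K m n"
    and L: "L \<in> mats_over K p m" and rank: "mat_rank (L * A) = mat_rank A"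
    and Q: "Q = pinv (L * (A + E)) * (L * (A + E))"
  shows "N (A * (1\<^sub>m n - Q)) \<le> N (L * E) * N (A * pinv (L * A))"
proof -
  note Ac = mats_over_carrier[OF A] and Ec = mats_over_carrier[OF E] and Lc = mats_over_carrier[OF L]
  note [simp] = carrier_matD[OF Ac] carrier_matD[OF Ec] carrier_matD[OF Lc]
  have Qc: "Q \<in> carrier_mat n n" unfolding Q by (auto intro!: carrier_matI)
  have LA: "L * A \<in> mats_over K p n" and LE: "L * E \<in> mats_over K p n"
    by (rule mult_closed[OF L A], rule mult_closed[OF L E])
  have QK: "Q \<in> mats_over K n n"
    unfolding Q by (intro mult_closed[of _ n p] pinv_closed mult_closed[OF L] add_closed A E)
  have adj: "mat_adjoint A * mat_adjoint L = mat_adjoint (L * A)"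
    "mat_adjoint E * mat_adjoint L = mat_adjoint (L * E)"
    "(mat_adjoint A + mat_adjoint E) * mat_adjoint L = mat_adjoint (L * (A + E))"
    by (simp_all add: mat_adjoint_mult mat_adjoint_add[OF Ac Ec])
  have QA: "mat_adjoint Q = Q" unfolding Q by (rule penrose(4))
  have "N ((1\<^sub>m n - Q) * mat_adjoint A)
      \<le> N (mat_adjoint (L * E)) * N (pinv (mat_adjoint (L * A)) * mat_adjoint A)"
  proof (rule perturbed_projection_error[OF adjoint_closed[OF A] adjoint_closed[OF E]
        adjoint_closed[OF L], unfolded adj])
    show "mat_rank (mat_adjoint (L * A)) = mat_rank (mat_adjoint A)" using rank by simp
    have "mat_adjoint Q = mat_adjoint (L * (A + E)) * pinv (mat_adjoint (L * (A + E)))"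
      unfolding Q pinv_adjoint by (simp add: mat_adjoint_mult)
    then show "Q = mat_adjoint (L * (A + E)) * pinv (mat_adjoint (L * (A + E)))"
      unfolding QA .
  qed
  moreover have "mat_adjoint (A * (1\<^sub>m n - Q)) = (1\<^sub>m n - Q) * mat_adjoint A"
    using mat_adjoint_minus[OF one_carrier_mat Qc] QA carrier_matD[OF Qc] by (simp add: mat_adjoint_mult)
  moreover have "pinv (mat_adjoint (L * A)) * mat_adjoint A = mat_adjoint (A * pinv (L * A))"
    unfolding pinv_adjoint by (simp add: mat_adjoint_mult)
  moreover have "A * (1\<^sub>m n - Q) \<in> mats_over K m n"
    by (intro mult_closed[OF A] minus_closed one_closed QK)
  moreover have "A * pinv (L * A) \<in> mats_over K m p" by (rule mult_closed[OF A pinv_closed[OF LA]])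
  ultimately show ?thesis using norm_adjoint LE by metis
qed

text \<open>
  The two rank conditions allow arbitrary matrices \<open>L\<close> and \<open>T\<close> in place of row and column selection. The
  error splits as \<open>(1 - P) A + P A (1 - Q) - P E Q\<close>, and projections do not increase the norm.
\<close>

lemma cur_projection_perturbation:
  assumes A: "A \<in> mats_over K m n" and E: "E \<in> mats_over K m n"
    and T: "T \<in> mats_over K n q" and rankT: "mat_rank (A * T) = mat_rank A"
    and L: "L \<in> mats_over K p m" and rankL: "mat_rank (L * A) = mat_rank A"
    and P: "P = (A + E) * T * pinv ((A + E) * T)"
    and Q: "Q = pinv (L * (A + E)) * (L * (A + E))"
  shows "N (A - P * (A + E) * Q)
    \<le> N (L * E) * N (A * pinv (L * A)) + N (E * T) * N (pinv (A * T) * A) + N E"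
proof -
  have PK: "P \<in> mats_over K m m"
    unfolding P by (intro mult_closed[of _ m q] pinv_closed mult_closed[OF _ T] add_closed A E)
  have QK: "Q \<in> mats_over K n n"
    unfolding Q by (intro mult_closed[of _ n p] pinv_closed mult_closed[OF L] add_closed A E)
  have Pproj: "orth_projection P" and Qproj: "orth_projection Q"
    unfolding P Q by (rule orth_projection_pinv)+
  note Ac = mats_over_carrier[OF A] and Ec = mats_over_carrier[OF E]
    and Pc = mats_over_carrier[OF PK] and Qc = mats_over_carrier[OF QK]
  note [simp] = carrier_matD[OF Ac] carrier_matD[OF Ec] carrier_matD[OF Pc] carrier_matD[OF Qc]
  have K1: "(1\<^sub>m m - P) * A \<in> mats_over K m n"
    by (intro mult_closed[OF _ A] minus_closed one_closed PK)
  have K2: "A * (1\<^sub>m n - Q) \<in> mats_over K m n"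
    by (intro mult_closed[OF A] minus_closed one_closed QK)
  have K3: "E * Q \<in> mats_over K m n" by (rule mult_closed[OF E QK])
  have K2': "P * (A * (1\<^sub>m n - Q)) \<in> mats_over K m n" and K3': "P * (E * Q) \<in> mats_over K m n"
    by (rule mult_closed[OF PK K2], rule mult_closed[OF PK K3])
  have AQ: "A * Q \<in> carrier_mat m n" and EQ: "E * Q \<in> carrier_mat m n"
    by (auto intro!: carrier_matI)
  have "P * (A + E) * Q = P * (A * Q) + P * (E * Q)"
    using add_mult_distrib_mat[OF Ac Ec Qc] mult_add_distrib_mat[OF Pc AQ EQ] by (simp add: mat_assoc)
  moreover have "(1\<^sub>m m - P) * A = A - P * A" by (rule one_minus_mult[OF Pc Ac])
  moreover have "P * (A * (1\<^sub>m n - Q)) = P * A - P * (A * Q)"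
    using mult_one_minus[OF Qc Ac] mult_minus_distrib_mat[OF Pc Ac AQ] by simp
  ultimately have "A - P * (A + E) * Q
      = (1\<^sub>m m - P) * A + P * (A * (1\<^sub>m n - Q)) - P * (E * Q)"
    by (intro eq_matI) (simp_all del: index_mult_mat(1))
  then have "N (A - P * (A + E) * Q) \<le> N ((1\<^sub>m m - P) * A + P * (A * (1\<^sub>m n - Q))) + N (P * (E * Q))"
    using norm_triangle_minus[OF add_closed[OF K1 K2'] K3'] by simp
  also have "\<dots> \<le> N ((1\<^sub>m m - P) * A) + N (P * (A * (1\<^sub>m n - Q))) + N (P * (E * Q))"
    using norm_triangle[OF K1 K2'] by simp
  also have "\<dots> \<le> N ((1\<^sub>m m - P) * A) + N (A * (1\<^sub>m n - Q)) + N E"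
    using norm_projection_le[OF PK Pproj K2] norm_projection_le[OF PK Pproj K3]
      norm_projection_right_le[OF QK Qproj E] by linarith
  also have "\<dots> \<le> N (E * T) * N (pinv (A * T) * A) + N (L * E) * N (A * pinv (L * A)) + N E"
    using perturbed_projection_error[OF A E T rankT P] perturbed_row_projection_error[OF A E L rankL Q]
    by linarith
  finally show ?thesis by simp
qed

end

section \<open>The perturbation bound for CUR approximations\<close>

theorem theorem4p1:
  fixes K :: "complex set" and m n k :: nat
    and A E At C R U Ct Rt EI EJ W S V WI VJ :: "complex mat"
    and I J :: "nat set"
    and N :: "complex mat \<Rightarrow> real"
  assumes K: "K = \<real> \<or> K = UNIV"
    and A: "A \<in> mats_over K m n"
    and E: "E \<in> mats_over K m n"
    and At: "At = A + E"
    and k: "k = mat_rank A"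
    and I: "I \<subseteq> {..<m}"
    and J: "J \<subseteq> {..<n}"
    and C: "C = submatrix A UNIV J"
    and R: "R = submatrix A I UNIV"
    and U: "U = submatrix A I J"
    and Ct: "Ct = submatrix At UNIV J"
    and Rt: "Rt = submatrix At I UNIV"
    and EI: "EI = submatrix E I UNIV"
    and EJ: "EJ = submatrix E UNIV J"
    and ranks: "mat_rank C = k" "mat_rank U = k" "mat_rank R = k"
    and svd: "compact_svd K A W S V"
    and WI: "WI = submatrix W I UNIV"
    and VJ: "VJ = submatrix V J UNIV"
    and norm: "matrix_norm_family K N" "normalized_norm K N" "uniformly_generated K N"
      "unitarily_invariant K N" "submultiplicative K N"
  shows "N (A - Ct * pinv Ct * At * pinv Rt * Rt)
           \<le> N EI * N (A * pinv R) + N EJ * N (pinv C * A) + 3 * N E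
       \<and> N (A - Ct * pinv Ct * At * pinv Rt * Rt)
           \<le> N E * (N (pinv WI) + N (pinv VJ) + 3)"
proof -
  interpret ui_norm K N using K norm by unfold_locales
  define L where "L = sel_rows m I"
  define M where "M = sel_rows n J"
  define p q where "p = card {i. i < m \<and> i \<in> I}" and "q = card {j. j < n \<and> j \<in> J}"
  have LK: "L \<in> mats_over K p m" and MK: "M \<in> mats_over K q n"
    unfolding L_def M_def p_def q_def by (rule sel_rows_closed)+
  have LL: "L * mat_adjoint L = 1\<^sub>m p" and MM: "M * mat_adjoint M = 1\<^sub>m q"
    unfolding L_def M_def p_def q_def by (rule sel_rows_coisometry)+
  have MK': "mat_adjoint M \<in> mats_over K n q" by (rule adjoint_closed[OF MK])
  note Ac = mats_over_carrier[OF A] and Ec = mats_over_carrier[OF E]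
    and Lc = mats_over_carrier[OF LK] and Mc = mats_over_carrier[OF MK]
  have Atc: "At \<in> carrier_mat m n" unfolding At using Ac Ec by simp
  note [simp] = carrier_matD[OF Ac] carrier_matD[OF Ec] carrier_matD[OF Atc]
    carrier_matD[OF Lc] carrier_matD[OF Mc]
  have svd': "W \<in> mats_over K m k" "mat_adjoint W * W = 1\<^sub>m k"
    "V \<in> mats_over K n k" "mat_adjoint V * V = 1\<^sub>m k"
    "S = mat_diag k (\<lambda>i. complex_of_real (singular_values A ! i))" "A = W * S * mat_adjoint V"
    using svd unfolding compact_svd_def Let_def k[symmetric] carrier_matD[OF Ac] by blast+
  have WK: "W \<in> mats_over K m k" and WW: "mat_adjoint W * W = 1\<^sub>m k"
    and VK: "V \<in> mats_over K n k" and VV: "mat_adjoint V * V = 1\<^sub>m k"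
    and Sc: "S \<in> carrier_mat k k" and AS: "A = W * S * mat_adjoint V"
    using svd'(1-4,6) by (simp_all only: svd'(5) mat_diag_dim)
  note Wc = mats_over_carrier[OF WK] and Vc = mats_over_carrier[OF VK]
  have rows: "R = L * A" "Rt = L * At" "EI = L * E" "WI = L * W"
    unfolding R Rt EI WI L_def using submatrix_rows Ac Atc Ec Wc by auto
  have cols: "C = A * mat_adjoint M" "Ct = At * mat_adjoint M" "EJ = E * mat_adjoint M" "VJ = M * V"
    unfolding C Ct EJ VJ M_def using submatrix_rows submatrix_cols Ac Atc Ec Vc by auto
  have rC: "mat_rank (A * mat_adjoint M) = mat_rank A" and rR: "mat_rank (L * A) = mat_rank A"
    using ranks k rows cols by auto
  have split: "Ct * pinv Ct * At * pinv Rt * Rt = Ct * pinv Ct * At * (pinv Rt * Rt)"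
    by (simp add: cols rows mat_assoc)
  have bound: "N (A - Ct * pinv Ct * At * pinv Rt * Rt)
      \<le> N EI * N (A * pinv R) + N EJ * N (pinv C * A) + N E"
    using cur_projection_perturbation[OF A E MK' rC LK rR refl refl]
    unfolding split unfolding rows cols At by simp
  have WIK: "WI \<in> mats_over K p k" unfolding rows by (rule mult_closed[OF LK WK])
  have VJK: "VJ \<in> mats_over K q k" unfolding cols by (rule mult_closed[OF MK VK])
  have AR: "N (A * pinv R) = N (pinv WI)"
    unfolding rows mult_pinv_row_sample[OF Wc Sc Vc WW VV AS k[symmetric] Lc rR]
    by (rule norm_isometry[OF WK WW pinv_closed[OF WIK[unfolded rows]]])
  \<comment> \<open>The isometry lemma acts on the left only, so the adjoint is taken first.\<close>
  have "N (pinv C * A) = N (V * pinv VJ)"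
    unfolding cols pinv_col_sample_mult[OF Wc Sc Vc WW VV AS k[symmetric] Mc rC]
    by (rule norm_adjoint[OF mult_closed[OF VK pinv_closed[OF VJK[unfolded cols]]]])
  also have "\<dots> = N (pinv VJ)" by (rule norm_isometry[OF VK VV pinv_closed[OF VJK]])
  finally have CA: "N (pinv C * A) = N (pinv VJ)" .
  have EIle: "N EI \<le> N E" unfolding rows by (rule norm_coisometry_le[OF LK LL E])
  have EJle: "N EJ \<le> N E"
  proof -
    have "mat_adjoint EJ = M * mat_adjoint E" unfolding cols by (simp add: mat_adjoint_mult)
    then show ?thesis
      using norm_coisometry_le[OF MK MM adjoint_closed[OF E]] norm_adjoint[OF E]
        norm_adjoint[OF mult_closed[OF E MK']] cols by simp
  qed
  have E0: "0 \<le> N E" by (rule norm_nonneg[OF E])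
  have "N EI * N (pinv WI) \<le> N E * N (pinv WI)" "N EJ * N (pinv VJ) \<le> N E * N (pinv VJ)"
    using EIle EJle norm_nonneg[OF pinv_closed[OF WIK]] norm_nonneg[OF pinv_closed[OF VJK]]
    by (auto intro: mult_right_mono)
  then show ?thesis using bound E0 unfolding AR CA by (simp add: algebra_simps)
qed

end
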